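(* Let $\mathcal{C}$ be a collection of cycles such that $C_3\notin\mathcal{C}$, and such that there exists some $k\geq 3$ so that for all $\ell\geq k$, either $C_\ell\in\mathcal{C}$ or $C_{\ell+1}\in\mathcal{C}$. Then for every $n$, \[\mathrm{sat}_g(n,\mathcal{C})\leq \tfrac{1}{2}(3k-1)(n-1).\]
   Context: $C_\ell$ denotes the cycle of length $\ell$. For a family of graphs $\mathcal{F}$, the $\mathcal{F}$-saturation game on $n$ vertices is played by two players, Max and Mini. Starting with Max, they alternately add edges to an initially empty graph on $n$ vertices, subject only to the constraint that no player may add an edge creating a subgraph isomorphic to a member of $\mathcal{F}$. The game ends when the graph is $\mathcal{F}$-saturated, i.e. it contains no member of $\mathcal{F}$ as a subgraph but adding any further edge would create one. Max wants the final graph to have as many edges as possible, Mini as few as possible. $\mathrm{sat}_g(n,\mathcal{F})$ denotes the number of edges in the final graph when both players play optimally. *)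

theory Defs
  imports Complex_Main
begin

text \<open>A finite simple graph is a pair of a vertex set and a set of two-element edges.\<close>

type_synonym 'a graph = "'a set \<times> 'a set set"

definition has_subgraph_iso :: "'a graph \<Rightarrow> 'b graph \<Rightarrow> bool" where
  "has_subgraph_iso G H \<longleftrightarrow>
     (\<exists>f. inj_on f (fst H) \<and> f ` fst H \<subseteq> fst G \<and> (\<lambda>e. f ` e) ` snd H \<subseteq> snd G)"

definition family_free :: "'b graph set \<Rightarrow> 'a graph \<Rightarrow> bool" where
  "family_free F G \<longleftrightarrow> (\<forall>H\<in>F. \<not> has_subgraph_iso G H)"

text \<open>The cycle of length \<open>l\<close>; it is a simple graph with \<open>l\<close> edges only if \<open>l \<ge> 3\<close>.\<close>

definition cycle_graph :: "nat \<Rightarrow> nat graph" where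
  "cycle_graph l = ({..<l}, {{i, Suc i mod l} | i. i < l})"

definition all_pairs :: "nat \<Rightarrow> nat set set" where
  "all_pairs n = {e. e \<subseteq> {..<n} \<and> card e = 2}"

text \<open>The game is played on the vertex set \<open>{..<n}\<close>, so a position is given by its edge set.\<close>

definition legal_moves :: "nat \<Rightarrow> 'b graph set \<Rightarrow> nat set set \<Rightarrow> nat set set" where
  "legal_moves n F E = {e \<in> all_pairs n - E. family_free F ({..<n}, insert e E)}"

definition saturated :: "nat \<Rightarrow> 'b graph set \<Rightarrow> nat set set \<Rightarrow> bool" where
  "saturated n F E \<longleftrightarrow> E \<subseteq> all_pairs n \<and> family_free F ({..<n}, E) \<and>
     (\<forall>e\<in>all_pairs n - E. \<not> family_free F ({..<n}, insert e E))"

lemma finite_all_pairs: "finite (all_pairs n)"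
  by (rule finite_subset[of _ "Pow {..<n}"]) (auto simp: all_pairs_def)

lemma legal_moves_empty_iff_saturated:
  assumes "E \<subseteq> all_pairs n" "family_free F ({..<n}, E)"
  shows "legal_moves n F E = {} \<longleftrightarrow> saturated n F E"
  using assms by (auto simp: legal_moves_def saturated_def)

text \<open>The number of edges at the end of the game under optimal play from the position \<open>E\<close>;
  the Boolean says whether it is Max's turn.\<close>

function game_value :: "nat \<Rightarrow> 'b graph set \<Rightarrow> bool \<Rightarrow> nat set set \<Rightarrow> nat" where
  "game_value n F max_turn E =
     (if legal_moves n F E = {} then card E
      else if max_turn
        then Max ((\<lambda>e. game_value n F False (insert e E)) ` legal_moves n F E)
        else Min ((\<lambda>e. game_value n F True (insert e E)) ` legal_moves n F E))"
  by pat_completeness auto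
termination
proof (relation "measure (\<lambda>(n, F, b, E). card (all_pairs n - E))")
  have "card (all_pairs n - insert e E) < card (all_pairs n - E)"
    if "e \<in> legal_moves n F E" for n e E and F :: "'b graph set"
    using that by (intro psubset_card_mono) (auto simp: legal_moves_def finite_all_pairs)
  then show
    "\<And>n (F :: 'b graph set) b E e. \<lbrakk>legal_moves n F E \<noteq> {}; b; e \<in> legal_moves n F E\<rbrakk>
      \<Longrightarrow> ((n, F, False, insert e E), (n, F, b, E)) \<in> measure (\<lambda>(n, F, b, E). card (all_pairs n - E))"
    "\<And>n (F :: 'b graph set) b E e. \<lbrakk>legal_moves n F E \<noteq> {}; \<not> b; e \<in> legal_moves n F E\<rbrakk>
      \<Longrightarrow> ((n, F, True, insert e E), (n, F, b, E)) \<in> measure (\<lambda>(n, F, b, E). card (all_pairs n - E))"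
    by auto
qed simp

text \<open>The defining equation is recursive without a constructor pattern, so it would loop as a
  simplification rule.\<close>

declare game_value.simps [simp del]

definition sat_g :: "nat \<Rightarrow> 'b graph set \<Rightarrow> nat" where
  "sat_g n F = game_value n F True {}"

end

theory Submission
  imports Defs
begin

text \<open>
  Mini keeps every cycle in a common block with a triangle. This forces all cycles to be short: two
  disjoint paths join a cycle to the triangle, and walking from one end of an arc of the cycle to
  the other through one or through two edges of the triangle yields two cycles of consecutive
  lengths, which must be below \<open>k\<close>. Looking at the closing edges at an end of a longest path, one
  finds a vertex of degree at most \<open>(3k - 1)/2\<close> in every subgraph, and deleting such vertices one
  by one bounds the number of edges.

  After each of her moves Mini also has the bridges form a matching, up to one extra bridge. Then
  a cycle closed by Max either runs through a block containing a triangle, or is itself a triangle,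
  or is a square, to which Mini adds a chord. If two bridges share a vertex, she closes a triangle
  over them. If the bridges form a matching, any move of hers preserves the invariant.
\<close>

section \<open>Walks and two disjoint paths\<close>

abbreviation walk :: "'a set set \<Rightarrow> 'a list \<Rightarrow> bool" where
  "walk E \<equiv> successively (\<lambda>x y. {x, y} \<in> E)"

text \<open>The vertex \<open>w\<close> is the one deleted. Quantified over \<open>w\<close>, this
  says that no single vertex separates, the form in which Menger's theorem and blocks enter.\<close>

definition reach :: "'a set set \<Rightarrow> 'a \<Rightarrow> 'a \<Rightarrow> 'a \<Rightarrow> bool" where
  "reach E w a b \<longleftrightarrow> (\<exists>p. p \<noteq> [] \<and> walk E p \<and> hd p = a \<and> last p = b \<and> w \<notin> set p)"

lemma walk_mono: "walk E p \<Longrightarrow> E \<subseteq> E' \<Longrightarrow> walk E' p"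
  by (erule successively_mono) auto

lemma walk_rev: "walk E (rev p) \<longleftrightarrow> walk E p"
  by (simp add: insert_commute)

lemma walk_join:
  assumes "p \<noteq> []" "q \<noteq> []" "walk E p" "walk E q" "last p = hd q"
  shows "walk E (p @ tl q)" "last (p @ tl q) = last q" "set (p @ tl q) = set p \<union> set q"
proof -
  obtain x q' where q: "q = x # q'" using assms(2) by (cases q) auto
  show "walk E (p @ tl q)"
    using assms q by (auto simp: successively_append_iff successively_Cons)
  show "last (p @ tl q) = last q" using assms q by auto
  show "set (p @ tl q) = set p \<union> set q" using assms q last_in_set[of p] by auto
qed

lemma walk_remove_edge:
  assumes "walk E p" "x \<in> e" "x \<notin> set p"
  shows "walk (E - {e}) p"
  using assms(1) by (rule successively_mono) (use assms(2,3) in auto)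

text \<open>A walk without repeated vertices passes \<open>e\<close> at most once, so both pieces
  around that passage avoid it.\<close>

lemma walk_split_edge:
  assumes "walk E p" "distinct p" "\<not> walk (E - {e}) p"
  shows "\<exists>as x y bs. p = as @ x # y # bs \<and> e = {x, y} \<and>
           walk (E - {e}) (as @ [x]) \<and> walk (E - {e}) (y # bs)"
  using assms
proof (induction p rule: induct_list012)
  case (3 x y r)
  show ?case
  proof (cases "{x, y} = e")
    case True
    then have "walk (E - {e}) (y # r)"
      using 3 by (intro walk_remove_edge[of _ _ x]) auto
    then show ?thesis using True by (intro exI[of _ "[]"] exI[of _ x] exI[of _ y] exI[of _ r]) auto
  next
    case False
    then have n: "\<not> walk (E - {e}) (y # r)" using 3 by auto
    have w: "walk E (y # r)" "distinct (y # r)" using 3 by auto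
    obtain as u v bs where *: "y # r = as @ u # v # bs" "e = {u, v}"
      "walk (E - {e}) (as @ [u])" "walk (E - {e}) (v # bs)"
      using 3(2)[OF w n] by blast
    have "walk (E - {e}) ((x # as) @ [u])"
      using * 3(3) False by (cases as) auto
    then show ?thesis using * by (intro exI[of _ "x # as"] exI[of _ u] exI[of _ v] exI[of _ bs]) auto
  qed
qed auto

lemma reach_sym: "reach E w a b \<Longrightarrow> reach E w b a"
  unfolding reach_def using walk_rev hd_rev last_rev by (metis rev_is_Nil_conv set_rev)

lemma reach_trans:
  assumes "reach E w a b" "reach E w b c"
  shows "reach E w a c"
proof -
  obtain p q where "p \<noteq> []" "walk E p" "hd p = a" "last p = b" "w \<notin> set p"
     "q \<noteq> []" "walk E q" "hd q = b" "last q = c" "w \<notin> set q"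
    using assms unfolding reach_def by blast
  then show ?thesis
    unfolding reach_def using walk_join[of p q E] by (intro exI[of _ "p @ tl q"]) auto
qed

lemma reach_mono: "reach E w a b \<Longrightarrow> E \<subseteq> E' \<Longrightarrow> reach E' w a b"
  unfolding reach_def using walk_mono by blast

lemma walk_infix: "walk E (p @ q @ r) \<Longrightarrow> walk E q"
  by (auto simp: successively_append_iff)

lemma split_list_inter: "set xs \<inter> A \<noteq> {} \<Longrightarrow> \<exists>x ys zs. x \<in> A \<and> xs = ys @ x # zs"
  by (meson disjoint_iff split_list)

text \<open>Among the walks from \<open>A\<close> to \<open>B\<close> inside \<open>set p\<close>,
  one of least length works: a second visit to \<open>A\<close>, an early visit to \<open>B\<close>
  or a repeated vertex would permit a shortcut.\<close>

lemma walk_trim: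
  assumes "walk E p" "p \<noteq> []" "hd p \<in> A" "last p \<in> B"
  obtains q where "walk E q" "q \<noteq> []" "hd q \<in> A" "last q \<in> B" "distinct q" "set q \<subseteq> set p"
    "set (tl q) \<inter> A = {}" "set (butlast q) \<inter> B = {}"
proof -
  define Q where "Q q \<longleftrightarrow> walk E q \<and> q \<noteq> [] \<and> hd q \<in> A \<and> last q \<in> B \<and> set q \<subseteq> set p" for q
  have "Q p" using assms by (simp add: Q_def)
  then obtain q where q: "Q q" and min: "\<And>r. Q r \<Longrightarrow> length q \<le> length r"
    using ex_has_least_nat[of Q p length] by blast
  have tl: "set (tl q) \<inter> A = {}"
  proof (rule ccontr)
    assume "\<not> ?thesis"
    then obtain a r s where a: "a \<in> A" "tl q = r @ a # s" using split_list_inter by metis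
    obtain h where e: "q = (h # r) @ a # s" using q a(2) by (cases q) (auto simp: Q_def)
    have "Q (a # s)" using q a(1) walk_infix[of E "h # r" "a # s" "[]"] unfolding Q_def e by auto
    from min[OF this] show False by (simp add: e)
  qed
  have bl: "set (butlast q) \<inter> B = {}"
  proof (rule ccontr)
    assume "\<not> ?thesis"
    then obtain b r s where b: "b \<in> B" "butlast q = r @ b # s" using split_list_inter by metis
    obtain h where e: "q = r @ b # s @ [h]"
      using q b(2) by (cases q rule: rev_cases) (auto simp: Q_def)
    have "Q (r @ [b])"
      using q b(1) walk_infix[of E "[]" "r @ [b]" "s @ [h]"] unfolding Q_def e by (cases r) auto
    from min[OF this] show False by (simp add: e)
  qed
  have "distinct q"
  proof (rule ccontr)
    assume "\<not> ?thesis"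
    then obtain xs ys zs y where e: "q = xs @ [y] @ ys @ [y] @ zs"
      using not_distinct_decomp by blast
    have "walk E (xs @ [y])" "walk E ([y] @ zs)"
      using q walk_infix[of E "[]" "xs @ [y]" "ys @ [y] @ zs"] walk_infix[of E "xs @ [y] @ ys" "[y] @ zs" "[]"]
      unfolding Q_def e by auto
    then have "walk E (xs @ [y] @ zs)" using walk_join(1)[of "xs @ [y]" "[y] @ zs" E] by simp
    moreover have "hd (xs @ [y] @ zs) = hd q" unfolding e by (cases xs) auto
    moreover have "last (xs @ [y] @ zs) = last q" unfolding e by simp
    moreover have "set (xs @ [y] @ zs) \<subseteq> set q" unfolding e by auto
    ultimately have "Q (xs @ [y] @ zs)" using q unfolding Q_def
      by (metis Nil_is_append_conv not_Cons_self2 subset_trans)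
    from min[OF this] show False by (simp add: e)
  qed
  then show ?thesis using that q tl bl unfolding Q_def by blast
qed

section \<open>Menger's theorem for two disjoint paths\<close>

lemma reach_prefix:
  assumes "walk E p" "u \<in> set p" "u \<noteq> s" "s \<notin> set (butlast p)"
  shows "reach E s (hd p) u"
proof -
  obtain q r where p: "p = q @ u # r" using assms(2) by (auto dest: split_list)
  have "s \<notin> set (q @ [u])" using assms p by (cases r) (auto simp: butlast_append)
  moreover have "walk E (q @ [u])" using assms p by (auto simp: successively_append_iff)
  moreover have "hd (q @ [u]) = hd p" using p by (cases q) auto
  ultimately show ?thesis unfolding reach_def by (intro exI[of _ "q @ [u]"]) auto
qed

text \<open>The step of Goering's proof of Menger's theorem: \<open>s\<close> separates \<open>A\<close> from \<open>B\<close> once the edge \<open>xy\<close> is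
  deleted, so a separator of \<open>A\<close> from \<open>{s, x}\<close> in the smaller graph separates \<open>A\<close> from \<open>B\<close>.\<close>

lemma reach_half:
  assumes no: "\<And>a b. a \<in> A \<Longrightarrow> b \<in> B \<Longrightarrow> \<not> reach (E - {{x, y}}) s a b"
    and conn: "\<And>w. \<exists>a\<in>A. \<exists>b\<in>B. reach E w a b"
    and y: "reach (E - {{x, y}}) s y b0" "b0 \<in> B"
  shows "\<exists>a\<in>A. \<exists>b\<in>{s, x}. reach (E - {{x, y}}) w a b"
proof -
  obtain R where R: "R \<noteq> []" "walk E R" "hd R \<in> A" "last R \<in> B" "w \<notin> set R"
    using conn[of w] unfolding reach_def by blast
  \<comment> \<open>A walk avoiding both would keep clear of the edge \<open>{x, y}\<close> and of
    \<open>s\<close>, against \<open>no\<close>.\<close>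
  have "set R \<inter> {s, x} \<noteq> {}"
  proof
    assume *: "set R \<inter> {s, x} = {}"
    then have "walk (E - {{x, y}}) R" using R by (intro walk_remove_edge[of _ _ x]) auto
    then show False using no[of "hd R" "last R"] R * unfolding reach_def by blast
  qed
  then obtain z r1 r2 where z: "z \<in> {s, x}" "R = r1 @ z # r2" using split_list_inter by metis
  have w: "walk E (r1 @ [z])" using R(2) walk_infix[of E "[]" "r1 @ [z]" r2] by (simp add: z(2))
  have h: "hd (r1 @ [z]) \<in> A" using R(3) z(2) by (cases r1) auto
  obtain q where q: "walk E q" "q \<noteq> []" "hd q \<in> A" "last q \<in> {s, x}" "distinct q"
      "set q \<subseteq> set (r1 @ [z])" "set (butlast q) \<inter> {s, x} = {}"
    by (rule walk_trim[of E "r1 @ [z]" A "{s, x}"]) (use z(1) w h in auto)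
  have w: "w \<notin> set q" using q(6) R(5) z(2) by auto
  have "walk (E - {{x, y}}) q"
  proof (rule ccontr)
    assume "\<not> ?thesis"
    then obtain as u v bs where s: "q = as @ u # v # bs" "{x, y} = {u, v}"
      "walk (E - {{x, y}}) (as @ [u])"
      using walk_split_edge[OF q(1,5)] by blast
    \<comment> \<open>As \<open>q\<close> meets \<open>{s, x}\<close> only at its end, it could run
      through the deleted edge only from \<open>y\<close> to \<open>x\<close>. Then \<open>A\<close>
      reaches \<open>y\<close> off \<open>s\<close>, and from there \<open>B\<close>.\<close>
    have "u \<noteq> x" using q(7) s(1) by (auto simp: butlast_append)
    then have uv: "u = y" using s(2) by (auto simp: doubleton_eq_iff)
    have "s \<notin> set (as @ [u])" using q(7) s(1) by (auto simp: butlast_append)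
    moreover have "hd (as @ [u]) = hd q" using s(1) by (cases as) auto
    ultimately have "reach (E - {{x, y}}) s (hd q) y"
      unfolding reach_def using s(3) uv by (intro exI[of _ "as @ [u]"]) auto
    then show False using no[OF q(3) y(2)] reach_trans[OF _ y(1)] by blast
  qed
  then have "reach (E - {{x, y}}) w (hd q) (last q)" unfolding reach_def using q(2) w by blast
  then show ?thesis using q(3,4) by blast
qed

text \<open>By induction on the number of edges. If deleting the edge \<open>{x, y}\<close> lets
  some \<open>s\<close> separate \<open>A\<close> from \<open>B\<close>, two disjoint walks from
  \<open>A\<close> to \<open>{s, x}\<close> and two from \<open>B\<close> to \<open>{s, y}\<close>
  are glued at \<open>s\<close> and along that edge.\<close>

theorem two_disjoint_walks:
  assumes "finite E" "\<And>w. \<exists>a\<in>A. \<exists>b\<in>B. reach E w a b"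
  shows "\<exists>p q. p \<noteq> [] \<and> q \<noteq> [] \<and> walk E p \<and> walk E q \<and> hd p \<in> A \<and> hd q \<in> A \<and>
           last p \<in> B \<and> last q \<in> B \<and> set p \<inter> set q = {}"
  using assms
proof (induction "card E" arbitrary: E A B rule: less_induct)
  case less
  show ?case
  proof (cases "E = {}")
    case True
    \<comment> \<open>Without edges every walk is a single vertex, so \<open>A\<close> and
      \<open>B\<close> share a vertex other than any given \<open>w\<close>, hence two.\<close>
    have *: "\<exists>a. a \<in> A \<and> a \<in> B \<and> a \<noteq> w" for w
    proof -
      obtain p where p: "p \<noteq> []" "walk E p" "hd p \<in> A" "last p \<in> B" "w \<notin> set p"
        using less(3)[of w] unfolding reach_def by blast
      then obtain a where "p = [a]" using True by (cases p rule: remdups_adj.cases) auto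
      then show ?thesis using p by auto
    qed
    then obtain a b where "a \<in> A" "a \<in> B" "b \<in> A" "b \<in> B" "a \<noteq> b" by metis
    then show ?thesis by (intro exI[of _ "[a]"] exI[of _ "[b]"]) auto
  next
    case False
    then obtain e where e: "e \<in> E" by blast
    define E' where "E' = E - {e}"
    have card: "card E' < card E" "finite E'"
      using card_Diff1_less[OF less(2) e] less(2) by (auto simp: E'_def simp del: card_Diff_insert)
    show ?thesis
    proof (cases "\<forall>w. \<exists>a\<in>A. \<exists>b\<in>B. reach E' w a b")
      case True
      then obtain p q where "p \<noteq> []" "q \<noteq> []" "walk E' p" "walk E' q" "hd p \<in> A" "hd q \<in> A"
           "last p \<in> B" "last q \<in> B" "set p \<inter> set q = {}"
        using less(1)[OF card, of A B] by blast
      then show ?thesis using walk_mono[of E' _ E] unfolding E'_def by blast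
    next
      case False
      then obtain s where s: "\<And>a b. a \<in> A \<Longrightarrow> b \<in> B \<Longrightarrow> \<not> reach E' s a b" by blast
      obtain P0 where P0: "walk E P0" "P0 \<noteq> []" "hd P0 \<in> A" "last P0 \<in> B" and sP0: "s \<notin> set P0"
        using less(3)[of s] unfolding reach_def by blast
      obtain P where P: "walk E P" "P \<noteq> []" "hd P \<in> A" "last P \<in> B" "s \<notin> set P" "distinct P"
        by (rule walk_trim[OF P0]) (use sP0 in auto)
      have "\<not> walk E' P" using s[OF P(3,4)] P unfolding reach_def by blast
      then obtain as x y bs where xy: "P = as @ x # y # bs" "e = {x, y}"
          "walk E' (as @ [x])" "walk E' (y # bs)"
        using walk_split_edge[OF P(1,6)] unfolding E'_def by blast
      have rx: "reach E' s (hd P) x" unfolding reach_def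
        using xy(1,3) P(5) by (intro exI[of _ "as @ [x]"]) (cases as; auto)
      have ry: "reach E' s y (last P)" unfolding reach_def
        using xy(1,4) P(5) by (intro exI[of _ "y # bs"]) auto
      have sxy: "s \<noteq> x" "s \<noteq> y" using P(5) xy(1) by auto
      have E'x: "E' = E - {{x, y}}" and E'y: "E' = E - {{y, x}}"
        by (auto simp: E'_def xy(2) insert_commute)
      have conn1: "\<exists>a\<in>A. \<exists>b\<in>{s, x}. reach E' w a b" for w
        unfolding E'x by (rule reach_half[of A B _ _ _ _ "last P"])
          (use s ry less(3) P(4) in \<open>auto simp: E'x\<close>)
      have conn2: "\<exists>a\<in>B. \<exists>b\<in>{s, y}. reach E' w a b" for w
        unfolding E'y
      proof (rule reach_half[of B A _ _ _ _ "hd P"])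
        show "\<exists>a\<in>B. \<exists>b\<in>A. reach E w a b" for w using less(3)[of w] reach_sym by metis
        show "\<not> reach (E - {{y, x}}) s a b" if "a \<in> B" "b \<in> A" for a b
          using s[OF that(2,1)] reach_sym unfolding E'y by metis
        show "reach (E - {{y, x}}) s x (hd P)" using reach_sym[OF rx] unfolding E'y .
      qed (fact P(3))
      \<comment> \<open>The induction hypothesis, with both walks trimmed to meet
        \<open>{s, z}\<close> only at their ends; being disjoint they end in different
        vertices.\<close>
      have pair: "\<exists>p q. p \<noteq> [] \<and> q \<noteq> [] \<and> walk E' p \<and> walk E' q \<and> hd p \<in> C \<and> hd q \<in> C \<and>
           last p = s \<and> last q = z \<and> set p \<inter> set q = {} \<and> s \<notin> set (butlast p) \<and> s \<notin> set (butlast q)"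
        if c: "\<And>w. \<exists>a\<in>C. \<exists>b\<in>{s, z}. reach E' w a b" and "s \<noteq> z" for C z
      proof -
        obtain p0 q0 where p0: "walk E' p0" "p0 \<noteq> []" "hd p0 \<in> C" "last p0 \<in> {s, z}"
           and q0: "walk E' q0" "q0 \<noteq> []" "hd q0 \<in> C" "last q0 \<in> {s, z}"
           and d: "set p0 \<inter> set q0 = {}"
          using less(1)[OF card c] by blast
        obtain p where p: "walk E' p" "p \<noteq> []" "hd p \<in> C" "last p \<in> {s, z}" "set p \<subseteq> set p0"
            "set (butlast p) \<inter> {s, z} = {}"
          by (rule walk_trim[OF p0])
        obtain q where q: "walk E' q" "q \<noteq> []" "hd q \<in> C" "last q \<in> {s, z}" "set q \<subseteq> set q0"
            "set (butlast q) \<inter> {s, z} = {}"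
          by (rule walk_trim[OF q0])
        have d': "set p \<inter> set q = {}" using p(5) q(5) d by blast
        have "last p \<noteq> last q" using d' last_in_set[OF p(2)] last_in_set[OF q(2)] by auto
        then consider "last p = s" "last q = z" | "last p = z" "last q = s" using p(4) q(4) by auto
        then show ?thesis
        proof cases
          case 1
          then show ?thesis using p q d' by (intro exI[of _ p] exI[of _ q]) auto
        next
          case 2
          then show ?thesis using p q d' by (intro exI[of _ q] exI[of _ p]) auto
        qed
      qed
      obtain p1 p2 where p: "p1 \<noteq> []" "p2 \<noteq> []" "walk E' p1" "walk E' p2" "hd p1 \<in> A" "hd p2 \<in> A"
           "last p1 = s" "last p2 = x" "set p1 \<inter> set p2 = {}" "s \<notin> set (butlast p1)" "s \<notin> set (butlast p2)"
        using pair[OF conn1 sxy(1)] by blast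
      obtain q1 q2 where q: "q1 \<noteq> []" "q2 \<noteq> []" "walk E' q1" "walk E' q2" "hd q1 \<in> B" "hd q2 \<in> B"
           "last q1 = s" "last q2 = y" "set q1 \<inter> set q2 = {}" "s \<notin> set (butlast q1)" "s \<notin> set (butlast q2)"
        using pair[OF conn2 sxy(2)] by blast
      \<comment> \<open>A walk from \<open>A\<close> and one from \<open>B\<close> that meet off
        \<open>s\<close> would join \<open>A\<close> to \<open>B\<close> in \<open>E'\<close>
        without \<open>s\<close>.\<close>
      have meet: "u = s" if "u \<in> set \<alpha>" "u \<in> set \<beta>" "walk E' \<alpha>" "walk E' \<beta>" "hd \<alpha> \<in> A" "hd \<beta> \<in> B"
          "s \<notin> set (butlast \<alpha>)" "s \<notin> set (butlast \<beta>)" for u \<alpha> \<beta>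
      proof (rule ccontr)
        assume "u \<noteq> s"
        then have "reach E' s (hd \<alpha>) u" "reach E' s (hd \<beta>) u" using reach_prefix that by metis+
        then show False using s that reach_sym reach_trans by metis
      qed
      have s_in: "s \<in> set p1" "s \<in> set q1" using p(1,7) q(1,7) last_in_set by metis+
      have j: "walk E' (p1 @ tl (rev q1))" "last (p1 @ tl (rev q1)) = hd q1"
         "set (p1 @ tl (rev q1)) = set p1 \<union> set q1"
        using walk_join[of p1 "rev q1" E'] p q by (auto simp: hd_rev last_rev insert_commute)
      have "walk E (p2 @ rev q2)"
        using p q e walk_mono[of E' _ E] unfolding xy(2)
        by (auto simp: successively_append_iff hd_rev insert_commute E'_def)
      moreover have "walk E (p1 @ tl (rev q1))" using j(1) by (rule walk_mono) (auto simp: E'_def)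
      moreover have "set (p1 @ tl (rev q1)) \<inter> set (p2 @ rev q2) = {}"
        unfolding j(3) using p(9) q(9) s_in meet[of _ p1 q2] meet[of _ p2 q1] p q by auto
      ultimately show ?thesis using p q j(2)
        by (intro exI[of _ "p1 @ tl (rev q1)"] exI[of _ "p2 @ rev q2"]) (auto simp: last_rev)
    qed
  qed
qed

section \<open>Cycles in a block with a triangle\<close>

definition cyc :: "'a set set \<Rightarrow> 'a list \<Rightarrow> bool" where
  "cyc E xs \<longleftrightarrow> 3 \<le> length xs \<and> distinct xs \<and> walk E xs \<and> {last xs, hd xs} \<in> E"

lemma cyc_mono: "cyc E xs \<Longrightarrow> E \<subseteq> E' \<Longrightarrow> cyc E' xs"
  unfolding cyc_def using walk_mono by blast

lemma cyc_rotate: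
  assumes "cyc E (xs @ ys)"
  shows "cyc E (ys @ xs)"
  using assms unfolding cyc_def
  by (cases "xs = []"; cases "ys = []") (auto simp: successively_append_iff)

text \<open>A cycle minus a vertex is a path. With the cycle started at \<open>a\<close>, the
  vertices before \<open>w\<close> are reached forwards and those after \<open>w\<close>
  backwards.\<close>

lemma cyc_reach:
  assumes "cyc E xs" "a \<in> set xs" "b \<in> set xs" "w \<noteq> a" "w \<noteq> b"
  shows "reach E w a b"
proof -
  have walk_reach: "reach E w a b" if wr: "walk E (a # ys)" "w \<notin> set (a # ys)" "b \<in> set (a # ys)" for ys
  proof -
    obtain q r where "a # ys = q @ b # r" using split_list[OF wr(3)] by blast
    then have qr: "a # ys = q @ b # r" by simp
    have "walk E (q @ [b])" using walk_infix[of E "[]" "q @ [b]" r] wr(1) unfolding qr by simp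
    moreover have "w \<notin> set (q @ [b])" using wr(2) unfolding qr by simp
    moreover have "hd (q @ [b]) = a" using qr by (cases q) auto
    ultimately show ?thesis unfolding reach_def by (intro exI[of _ "q @ [b]"]) auto
  qed
  obtain q r where xs: "xs = q @ a # r" using split_list[OF assms(2)] by blast
  have c: "cyc E (a # r @ q)" using cyc_rotate[of E q "a # r"] assms(1) by (simp add: xs)
  have b: "b \<in> set (a # r @ q)" using assms(3) xs by auto
  show ?thesis
  proof (cases "w \<in> set xs")
    case False
    then show ?thesis using walk_reach[of "r @ q"] c b xs by (auto simp: cyc_def)
  next
    case True
    then obtain s t where w: "r @ q = s @ w # t" using split_list[of w "r @ q"] assms(4) xs by auto
    have c': "cyc E (w # t @ a # s)" using cyc_rotate[of E "a # s" "w # t"] c w by simp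
    then have ta: "walk E (t @ a # s)" "w \<notin> set (t @ a # s)" by (auto simp: cyc_def successively_Cons)
    have b': "b \<in> set t \<or> b \<in> set (a # s)" using b assms(5) unfolding w by auto
    show ?thesis
    proof (cases "b \<in> set (a # s)")
      case True
      then show ?thesis using walk_reach[of s] ta walk_infix[of E t "a # s" "[]"] by auto
    next
      case False
      have "walk E (a # rev t)" 
        using walk_infix[of E "[]" "t @ [a]" s] ta walk_rev[of E "t @ [a]"] by simp
      then show ?thesis using walk_reach[of "rev t"] ta b' False by auto
    qed
  qed
qed

text \<open>This turns a new cycle into an old path: rotated so that \<open>e\<close> becomes the
  closing edge, the cycle leaves a walk in \<open>E\<close>.\<close>

lemma cyc_insert:
  assumes "cyc (insert e E) xs" "\<not> cyc E xs"
  obtains ys where "set ys = set xs" "length ys = length xs" "distinct ys" "walk E ys"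
    "{last ys, hd ys} = e" "3 \<le> length ys"
proof (cases "walk (insert e E - {e}) xs")
  case True
  then have w: "walk E xs" by (rule walk_mono) auto
  then show ?thesis using assms that[of xs] unfolding cyc_def by auto
next
  case False
  then obtain as x y bs where xs: "xs = as @ x # y # bs" "e = {x, y}"
    using walk_split_edge[of "insert e E" xs e] assms(1) unfolding cyc_def by blast
  have c: "cyc (insert e E) (y # bs @ as @ [x])"
    using cyc_rotate[of _ "as @ [x]" "y # bs"] assms(1) xs(1) by simp
  \<comment> \<open>The edge \<open>e\<close> joins the first and the last vertex. It could recur
    between neighbours only if these two were the whole list, which has at least three
    entries.\<close>
  have "walk (insert e E - {e}) (y # bs @ as @ [x])"
  proof (rule ccontr)
    assume "\<not> ?thesis"
    then obtain cs u v ds where s: "y # bs @ as @ [x] = cs @ u # v # ds" "e = {u, v}"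
      using walk_split_edge[of "insert e E" _ e] c unfolding cyc_def by blast
    have len: "3 \<le> length (cs @ u # v # ds)" and d: "distinct (cs @ u # v # ds)"
      using c unfolding s(1) cyc_def by auto
    have hl: "hd (cs @ u # v # ds) = y" "last (cs @ u # v # ds) = x"
      using s(1) by (metis list.sel(1), metis append_Cons append_assoc last_snoc)
    show False using len d hl s(2) xs(2)
      by (cases cs; cases ds rule: rev_cases) (auto simp: doubleton_eq_iff)
  qed
  then have "walk E (y # bs @ as @ [x])" by (rule walk_mono) auto
  then show ?thesis using that[of "y # bs @ as @ [x]"] c xs by (auto simp: cyc_def)
qed

text \<open>The bounds on cycles and degrees below depend on the forbidden lengths only through this
  property.\<close>

definition no_consec :: "nat \<Rightarrow> 'a set set \<Rightarrow> bool" where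
  "no_consec k E \<longleftrightarrow> (\<forall>xs ys. cyc E xs \<longrightarrow> cyc E ys \<longrightarrow> k \<le> length xs \<longrightarrow> length ys \<noteq> Suc (length xs))"

lemma no_consec_subset: "no_consec k E' \<Longrightarrow> E \<subseteq> E' \<Longrightarrow> no_consec k E"
  unfolding no_consec_def using cyc_mono by blast

text \<open>The cycle \<open>r\<close> and its extension through the apex \<open>s\<close> have
  consecutive lengths.\<close>

lemma apex_bound:
  assumes "no_consec k E" "3 \<le> k" "walk E r" "distinct r" "{last r, hd r} \<in> E"
    "s \<notin> set r" "{last r, s} \<in> E" "{s, hd r} \<in> E"
  shows "length r < k"
proof (rule ccontr)
  assume "\<not> ?thesis"
  then have l: "k \<le> length r" by simp
  then have r: "r \<noteq> []" using assms(2) by auto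
  have "cyc E r" using assms l by (simp add: cyc_def)
  moreover have "cyc E (r @ [s])" using assms l r by (auto simp: cyc_def successively_append_iff)
  ultimately show False using assms(1) l unfolding no_consec_def by fastforce
qed

definition triangle :: "'a set set \<Rightarrow> 'a set \<Rightarrow> bool" where
  "triangle E T \<longleftrightarrow> card T = 3 \<and> (\<forall>x\<in>T. \<forall>y\<in>T. x \<noteq> y \<longrightarrow> {x, y} \<in> E)"

text \<open>The apex \<open>c\<close> may lie on the arc \<open>r\<close>; it then cuts \<open>r\<close> into two arcs, each of them short.\<close>

lemma arc_bound:
  assumes k: "no_consec k E" "3 \<le> k"
    and T: "triangle E {a, b, c}" "a \<noteq> b" "b \<noteq> c" "a \<noteq> c"
    and p: "walk E (u # p)" "distinct (u # p)" "last (u # p) = a"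
    and q: "walk E (v # q)" "distinct (v # q)" "last (v # q) = b"
    and r: "walk E (u # r @ [v])" "distinct (u # r @ [v])"
    and disj: "set (u # p) \<inter> set (v # q) = {}"
      "set p \<inter> set (r @ [v]) = {}" "set q \<inter> set (u # r) = {}" "c \<notin> set (u # p)" "c \<notin> set (v # q)"
  shows "c \<notin> set r \<Longrightarrow> length r + 2 < k" and "length r + 4 < 2 * k"
proof -
  have E: "{a, b} \<in> E" "{b, a} \<in> E" "{a, c} \<in> E" "{c, a} \<in> E" "{b, c} \<in> E" "{c, b} \<in> E"
    using T unfolding triangle_def by auto
  have up: "walk E (rev p @ [u])" "distinct (rev p @ [u])" "hd (rev p @ [u]) = a"
    using p walk_rev[of E "u # p"] by (auto simp: hd_append hd_rev)
  have ab: "a \<in> set (u # p)" "b \<in> set (v # q)" using p(3) q(3) last_in_set by blast+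
  show 1: "length r + 2 < k" if c: "c \<notin> set r"
  proof -
    have "walk E ((u # r @ [v]) @ q)" using walk_join(1)[OF _ _ r(1) q(1)] by simp
    then have "walk E ((rev p @ [u]) @ r @ v # q)" using walk_join(1)[OF _ _ up(1), of "u # r @ v # q"] by simp
    moreover have "hd ((rev p @ [u]) @ r @ v # q) = a" by (subst hd_append2) (use up(3) in auto)
    moreover have "last ((rev p @ [u]) @ r @ v # q) = b" using q(3) by simp
    \<comment> \<open>From \<open>a\<close> back along \<open>p\<close>, over the arc and along
      \<open>q\<close> to \<open>b\<close>: the edge \<open>{a, b}\<close> closes this path, and
      \<open>c\<close> is the apex.\<close>
    ultimately have "length ((rev p @ [u]) @ r @ v # q) < k"
      using E c disj p(2) q(2) r(2) by (intro apex_bound[OF k, of _ c]) auto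
    then show ?thesis by simp
  qed
  show "length r + 4 < 2 * k"
  proof (cases "c \<in> set r")
    case True
    then obtain r1 r2 where s: "r = r1 @ c # r2" using split_list by metis
    have "walk E ((rev p @ [u]) @ r1 @ [c])"
      using walk_join(1)[OF _ _ up(1), of "u # r1 @ [c]"] r(1) walk_infix[of E "[]" "u # r1 @ [c]" "r2 @ [v]"]
      unfolding s by simp
    moreover have "hd ((rev p @ [u]) @ r1 @ [c]) = a" by (subst hd_append2) (use up(3) in auto)
    \<comment> \<open>The path from \<open>a\<close> to \<open>c\<close> has apex \<open>b\<close>;
      the one from \<open>c\<close> to \<open>b\<close> below has apex \<open>a\<close>.\<close>
    ultimately have 2: "length ((rev p @ [u]) @ r1 @ [c]) < k"
      using E disj p(2) r(2) ab T s by (intro apex_bound[OF k, of _ b]) auto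
    have "walk E (c # r2 @ v # q)"
      using walk_join(1)[OF _ _ _ q(1), of "c # r2 @ [v]"] r(1) walk_infix[of E "u # r1" "c # r2 @ [v]" "[]"]
      unfolding s by simp
    then have 3: "length (c # r2 @ v # q) < k"
      using E disj q(2,3) r(2) ab T s by (intro apex_bound[OF k, of _ a]) auto
    show ?thesis using 2 3 s by simp
  next
    case False
    then show ?thesis using 1 k(2) by simp
  qed
qed

text \<open>No vertex separates the cycle from the triangle, i.e. they lie in a common block.\<close>

definition triangle_linked :: "'a set set \<Rightarrow> 'a list \<Rightarrow> bool" where
  "triangle_linked E xs \<longleftrightarrow> (\<exists>T. triangle E T \<and> (\<forall>w. \<exists>x\<in>set xs. \<exists>y\<in>T. reach E w x y))"

text \<open>Two disjoint walks to the triangle cut the cycle into two arcs. The third vertex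
  \<open>c\<close> of the triangle lies inside at most one, so the inner vertices number at most
  \<open>k - 3\<close> on one arc and \<open>2 * k - 5\<close> on the other; the starting points of
  the walks add two.\<close>

lemma triangle_linked_length:
  assumes "finite E" "no_consec k E" "3 \<le> k" "cyc E xs" "triangle_linked E xs"
  shows "length xs + 6 \<le> 3 * k"
proof -
  obtain T where T: "triangle E T" "\<And>w. \<exists>x\<in>set xs. \<exists>y\<in>T. reach E w x y"
    using assms(5) unfolding triangle_linked_def by blast
  obtain p0 q0 where p0: "walk E p0" "p0 \<noteq> []" "hd p0 \<in> set xs" "last p0 \<in> T"
    and q0: "walk E q0" "q0 \<noteq> []" "hd q0 \<in> set xs" "last q0 \<in> T" and d0: "set p0 \<inter> set q0 = {}"
    using two_disjoint_walks[OF assms(1) T(2)] by blast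
  obtain p' where p': "walk E p'" "p' \<noteq> []" "hd p' \<in> set xs" "last p' \<in> T" "distinct p'"
      "set p' \<subseteq> set p0" "set (tl p') \<inter> set xs = {}" "set (butlast p') \<inter> T = {}"
    by (rule walk_trim[OF p0])
  obtain q' where q': "walk E q'" "q' \<noteq> []" "hd q' \<in> set xs" "last q' \<in> T" "distinct q'"
      "set q' \<subseteq> set q0" "set (tl q') \<inter> set xs = {}" "set (butlast q') \<inter> T = {}"
    by (rule walk_trim[OF q0])
  obtain u p v q where up: "p' = u # p" and vq: "q' = v # q" using p'(2) q'(2) by (meson neq_Nil_conv)
  define a b where "a = last p'" and "b = last q'"
  have d: "set p' \<inter> set q' = {}" using p'(6) q'(6) d0 by blast
  have ab: "a \<noteq> b" "a \<in> set p'" "b \<in> set q'"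
    using d last_in_set[OF p'(2)] last_in_set[OF q'(2)] unfolding a_def b_def by auto
  have Tab: "a \<in> T" "b \<in> T" using p'(4) q'(4) by (auto simp: a_def b_def)
  have "finite T" using T(1) unfolding triangle_def by (metis card.infinite zero_neq_numeral)
  then have "card (T - {a, b}) = 1" using T(1) Tab ab unfolding triangle_def
    by (subst card_Diff_subset) auto
  then obtain c where c: "T - {a, b} = {c}" by (auto simp: card_1_singleton_iff)
  then have Tc: "T = {a, b, c}" "b \<noteq> c" "a \<noteq> c" using Tab by auto
  have setp: "set p' = insert a (set (butlast p'))" "set q' = insert b (set (butlast q'))"
    using append_butlast_last_id[OF p'(2)] append_butlast_last_id[OF q'(2)] unfolding a_def b_def
    by (metis Un_insert_right list.simps(15) set_append sup_bot.right_neutral empty_set)+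
  \<comment> \<open>The trimmed walks meet the triangle only at their ends \<open>a\<close> and
    \<open>b\<close>.\<close>
  have cpq: "c \<notin> set p'" "c \<notin> set q'" using setp p'(8) q'(8) Tc by auto
  obtain x1 x2 where "xs = x1 @ u # x2" using p'(3) up split_list by (metis list.sel(1))
  then have c1: "cyc E (u # x2 @ x1)" and s1: "set xs = set (u # x2 @ x1)"
      and l1: "length xs = length (u # x2 @ x1)"
    using cyc_rotate[of E x1 "u # x2"] assms(4) by (simp_all add: Un_commute)
  have "v \<noteq> u" using d up vq by auto
  then have "v \<in> set (x2 @ x1)" using q'(3) vq s1 by auto
  then obtain r s where rs: "x2 @ x1 = r @ v # s" using split_list by metis
  have cr: "cyc E (u # r @ v # s)" using c1 rs by simp
  have cs: "cyc E (v # s @ u # r)" using cyc_rotate[of E "u # r" "v # s"] cr by simp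
  have xs: "set xs = set (u # r @ v # s)" "length xs = length r + length s + 2"
  proof -
    have "set (x2 @ x1) = set (r @ v # s)" "length (x2 @ x1) = length (r @ v # s)" by (simp_all only: rs)
    then show "set xs = set (u # r @ v # s)" "length xs = length r + length s + 2"
      using s1 l1 by auto
  qed
  have "walk E (u # r @ [v])" "walk E (v # s @ [u])"
    using cr cs walk_infix[of E "[]" "u # r @ [v]" s] walk_infix[of E "[]" "v # s @ [u]" r]
    by (auto simp: cyc_def)
  moreover have dist: "distinct (u # r @ v # s)" using cr by (simp add: cyc_def)
  ultimately have w: "walk E (u # r @ [v])" "walk E (v # s @ [u])"
    and dr: "distinct (u # r @ [v])" and ds: "distinct (v # s @ [u])" by auto
  have p: "walk E (u # p)" "distinct (u # p)" "last (u # p) = a" "set p \<inter> set xs = {}"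
    using p' a_def unfolding up by auto
  have q: "walk E (v # q)" "distinct (v # q)" "last (v # q) = b" "set q \<inter> set xs = {}"
    using q' b_def unfolding vq by auto
  have T': "triangle E {a, b, c}" "triangle E {b, a, c}" using T(1) Tc(1) by (auto simp: insert_commute)
  have inx: "set (r @ [v]) \<subseteq> set xs" "set (u # r) \<subseteq> set xs" "set (s @ [u]) \<subseteq> set xs" "set (v # s) \<subseteq> set xs"
    unfolding xs(1) by auto
  have dj: "set p \<inter> set (r @ [v]) = {}" "set q \<inter> set (u # r) = {}"
     "set q \<inter> set (s @ [u]) = {}" "set p \<inter> set (v # s) = {}" using inx p(4) q(4) by blast+
  have d1: "set (u # p) \<inter> set (v # q) = {}" "set (v # q) \<inter> set (u # p) = {}"
    "c \<notin> set (u # p)" "c \<notin> set (v # q)" using d cpq unfolding up vq by blast+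
  have ne: "b \<noteq> a" using ab(1) by simp
  note A = arc_bound[OF assms(2,3) T'(1) ab(1) Tc(2,3) p(1-3) q(1-3) w(1) dr d1(1) dj(1,2) d1(3,4)]
  note B = arc_bound[OF assms(2,3) T'(2) ne Tc(3,2) q(1-3) p(1-3) w(2) ds d1(2) dj(3,4) d1(4,3)]
  have "c \<notin> set r \<or> c \<notin> set s" using dist by auto
  then show ?thesis using A(1) A(2) B(1) B(2) xs(2) by fastforce
qed

section \<open>Counting edges\<close>

text \<open>\<open>S\<close> and its shift by one are disjoint and lie in
  \<open>{a..Suc b}\<close>.\<close>

lemma card_no_consecutive:
  fixes S :: "nat set"
  assumes "S \<subseteq> {a..b}" "\<And>i. i \<in> S \<Longrightarrow> Suc i \<notin> S"
  shows "2 * card S \<le> Suc (Suc b) - a"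
proof -
  have f: "finite S" using assms(1) finite_subset by blast
  have "card (S \<union> Suc ` S) = card S + card (Suc ` S)"
    using f assms(2) by (intro card_Un_disjoint) auto
  also have "card (Suc ` S) = card S" by (simp add: card_image)
  finally have "2 * card S = card (S \<union> Suc ` S)" by simp
  also have "\<dots> \<le> card {a..Suc b}" using assms(1) by (intro card_mono) auto
  finally show ?thesis by simp
qed

text \<open>The last position \<open>m\<close> in \<open>S\<close> closes a cycle of length
  \<open>m + 1\<close>, which \<open>long\<close> bounds. Without consecutive positions
  \<open>S\<close> fills at most half of \<open>{1..m}\<close>, rounded up. Consecutive positions
  force \<open>m + 4 \<le> 2 * k\<close> and occur only below \<open>k\<close>.\<close>

lemma no_consec_closing_edges:
  fixes p :: "'a list"
  assumes k: "no_consec k E" "3 \<le> k"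
    and long: "\<And>xs. cyc E xs \<Longrightarrow> length xs + 1 \<le> 3 * k"
    and p: "walk E p" "distinct p"
  defines "S \<equiv> {i. 0 < i \<and> i < length p \<and> {hd p, p ! i} \<in> E}"
  shows "2 * card S + 1 \<le> 3 * k"
proof (cases "S = {}")
  case True
  then show ?thesis using k(2) by simp
next
  case False
  have fin: "finite S" by (rule finite_subset[of _ "{..<length p}"]) (auto simp: S_def)
  define m where "m = Max S"
  have mS: "m \<in> S" and le: "\<And>i. i \<in> S \<Longrightarrow> i \<le> m" using fin False by (auto simp: m_def)
  have ml: "m < length p" using mS by (simp add: S_def)
  have p0: "p \<noteq> []" using ml by auto
  have sub: "walk E (take i p)" "walk E (drop i p)" "distinct (take i p)" "distinct (drop i p)" for i
    using p walk_infix[of E "[]" "take i p" "drop i p"] walk_infix[of E "take i p" "drop i p" "[]"] by auto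
  have hd0: "hd p = p ! 0" using p0 by (simp add: hd_conv_nth)
  have hdt: "hd (take (Suc i) p) = hd p" for i using p0 by (cases p) auto
  have last_take: "last (take (Suc i) p) = p ! i" if "i < length p" for i
    using that by (simp add: take_Suc_conv_app_nth)
  have edge: "{p ! i, p ! Suc i} \<in> E" if "Suc i < length p" for i
    using p(1) that by (simp add: successively_conv_nth)
  show ?thesis
  proof (cases "\<exists>i\<in>S. Suc i \<in> S")
    case False
    have "2 * card S \<le> Suc (Suc m) - 1"
      by (rule card_no_consecutive) (use le False in \<open>auto simp: S_def\<close>)
    moreover have "m + 2 \<le> 3 * k"
    \<comment> \<open>For \<open>m = 1\<close> the only edge counted is the first edge of the path,
      which closes no cycle.\<close>
    proof (cases "m \<ge> 2")
      case True
      have "cyc E (take (Suc m) p)"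
        using True ml mS sub(1,3)[of "Suc m"] last_take[OF ml] hdt[of m]
        unfolding cyc_def S_def by (auto simp: insert_commute)
      from long[OF this] show ?thesis using ml by simp
    qed (use k(2) in simp)
    ultimately show ?thesis by simp
  next
    case True
    have consec: "Suc i < k" "m + 1 < k + i" if i: "i \<in> S" "Suc i \<in> S" for i
    proof -
      have il: "0 < i" "Suc i < length p" and e: "{hd p, p ! i} \<in> E" "{hd p, p ! Suc i} \<in> E"
        using i by (auto simp: S_def)
      \<comment> \<open>The initial segment up to \<open>p ! i\<close> is closed by the edge to its
        first vertex, with apex \<open>p ! Suc i\<close>.\<close>
      have "length (take (Suc i) p) < k"
      proof (rule apex_bound[OF k, of _ "p ! Suc i"])
        show "p ! Suc i \<notin> set (take (Suc i) p)"
          using p(2) il by (auto simp: in_set_conv_nth nth_eq_iff_index_eq)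
      qed (use sub il e edge[of i] last_take[of i] hdt[of i] in \<open>auto simp: insert_commute\<close>)
      then show "Suc i < k" using il by simp
      define r where "r = drop (Suc i) (take (Suc m) p)"
      have im: "Suc i \<le> m" using le i by blast
      have tk: "take (Suc m) p \<noteq> []" using p0 by simp
      have rl: "length r = m - i" using ml im by (simp add: r_def)
      then have r0: "r \<noteq> []" using im by auto
      have hr: "hd r = p ! Suc i" unfolding r_def using im ml by (subst hd_drop_conv_nth) auto
      have lr: "last r = p ! m" unfolding r_def using im ml last_take[OF ml] by (subst last_drop) auto
      have sr: "\<exists>j. i < j \<and> j < length p \<and> x = p ! j" if x: "x \<in> set r" for x
      proof -
        obtain j where "j < length r" "r ! j = x" using x by (auto simp: in_set_conv_nth)
        then show ?thesis using ml by (intro exI[of _ "Suc (i + j)"]) (auto simp: r_def)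
      qed
      have wr: "walk E r"
        unfolding r_def using sub(1)[of "Suc m"] walk_infix[of E "take (Suc i) (take (Suc m) p)" _ "[]"]
        by (metis append_Nil2 append_take_drop_id)
      have out: "p ! j \<notin> set r" if j: "j \<le> i" for j
      proof
        assume "p ! j \<in> set r"
        then obtain j' where "i < j'" "j' < length p" "p ! j = p ! j'" using sr by blast
        then show False using nth_eq_iff_index_eq[OF p(2), of j j'] j by simp
      qed
      \<comment> \<open>The segment from \<open>p ! Suc i\<close> to \<open>p ! m\<close> closes
        through the first vertex of \<open>p\<close>, and the apex \<open>p ! i\<close> fits between
        that vertex and \<open>p ! Suc i\<close>.\<close>
      have "length (r @ [hd p]) < k"
      proof (rule apex_bound[OF k, of _ "p ! i"])
        show "walk E (r @ [hd p])" using wr lr mS by (auto simp: successively_append_iff S_def insert_commute)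
        show "distinct (r @ [hd p])" using out[of 0] p(2) by (simp add: r_def hd0)
        have "p ! i \<noteq> p ! 0" using il p(2) p0 by (subst nth_eq_iff_index_eq) auto
        then show "p ! i \<notin> set (r @ [hd p])" using out[of i] by (simp add: hd0)
      qed (use hr r0 e edge[of i] il in \<open>auto simp: insert_commute\<close>)
      then show "m + 1 < k + i" using rl im by simp
    qed
    have m: "m + 4 \<le> 2 * k" using True consec by fastforce
    \<comment> \<open>Positions up to \<open>k - 2\<close> are counted trivially; from
      \<open>k - 1\<close> on no two are consecutive.\<close>
    have S: "S = (S \<inter> {1..k - 2}) \<union> (S \<inter> {k - 1..m})" using le by (fastforce simp: S_def)
    have "card (S \<inter> {1..k - 2}) \<le> k - 2" using card_mono[of "{1..k - 2}" "S \<inter> {1..k - 2}"] by simp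
    moreover have "2 * card (S \<inter> {k - 1..m}) \<le> Suc (Suc m) - (k - 1)"
      by (rule card_no_consecutive) (use consec in fastforce)+
    moreover have "card S \<le> card (S \<inter> {1..k - 2}) + card (S \<inter> {k - 1..m})"
      by (subst S) (rule card_Un_le)
    ultimately show ?thesis using m k(2) by linarith
  qed
qed

text \<open>The first vertex of a longest path has all its neighbours on the path, so the bound on
  closing edges is a bound on its degree.\<close>

lemma exists_low_degree:
  assumes k: "no_consec k E" "3 \<le> k"
    and long: "\<And>xs. cyc E xs \<Longrightarrow> length xs + 1 \<le> 3 * k"
    and V: "finite V" "E \<subseteq> {e. e \<subseteq> V \<and> card e = 2}" "V \<noteq> {}"
  shows "\<exists>x\<in>V. 2 * card {e \<in> E. x \<in> e} + 1 \<le> 3 * k"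
proof -
  define P where "P p \<longleftrightarrow> walk E p \<and> distinct p \<and> p \<noteq> [] \<and> set p \<subseteq> V" for p
  obtain x0 where "x0 \<in> V" using V(3) by blast
  then have ex: "P [x0]" by (simp add: P_def)
  have bound: "length p \<le> card V" if "P p" for p
    using that V(1) unfolding P_def by (metis card_mono distinct_card)
  obtain p where p: "P p" and max: "\<And>q. P q \<Longrightarrow> length q \<le> length p"
    using ex_has_greatest_nat[of P "[x0]" length "Suc (card V)"] ex bound by (metis less_Suc_eq_le)
  obtain x r where xr: "p = x # r" using p by (cases p) (auto simp: P_def)
  define S where "S = {i. 0 < i \<and> i < length p \<and> {hd p, p ! i} \<in> E}"
  have S: "2 * card S + 1 \<le> 3 * k"
    unfolding S_def by (rule no_consec_closing_edges[OF k long]) (use p in \<open>auto simp: P_def\<close>)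
  have "{e \<in> E. x \<in> e} \<subseteq> (\<lambda>i. {x, p ! i}) ` S"
  proof
    fix e assume e: "e \<in> {e \<in> E. x \<in> e}"
    then have "e \<subseteq> V" "card e = 2" using V(2) by auto
    then obtain y where y: "e = {x, y}" "y \<noteq> x" "y \<in> V"
      using e by (auto simp: card_2_iff)
    have "y \<in> set p"
    proof (rule ccontr)
      assume "y \<notin> set p"
      then have "P (y # p)" using p y e unfolding P_def xr by (auto simp: insert_commute)
      from max[OF this] show False by simp
    qed
    then obtain i where "i < length p" "p ! i = y" by (auto simp: in_set_conv_nth)
    moreover from this have "0 < i" using y xr by (cases i) auto
    ultimately show "e \<in> (\<lambda>i. {x, p ! i}) ` S" using y e by (auto simp: S_def xr)
  qed
  then have "card {e \<in> E. x \<in> e} \<le> card S"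
    by (rule surj_card_le[rotated]) (auto simp: S_def)
  then show ?thesis using S p xr by (intro bexI[of _ x]) (auto simp: P_def)
qed

text \<open>Deleting a vertex of low degree loses at most \<open>(3 * k - 1) / 2\<close> edges. A
  single vertex spans no edge, hence the factor \<open>card V - 1\<close>.\<close>

theorem no_consec_card_edges:
  assumes k: "no_consec k E" "3 \<le> k"
    and long: "\<And>xs. cyc E xs \<Longrightarrow> length xs + 1 \<le> 3 * k"
    and V: "finite V" "E \<subseteq> {e. e \<subseteq> V \<and> card e = 2}" "V \<noteq> {}"
  shows "2 * card E \<le> (3 * k - 1) * (card V - 1)"
  using assms
proof (induction "card V" arbitrary: V E)
  case 0
  then show ?case by simp
next
  case (Suc n)
  have finE: "finite E" using Suc(6,7) finite_subset[of E "Pow V"] by auto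
  show ?case
  proof (cases "E = {}")
    case False
    obtain x where x: "x \<in> V" "2 * card {e \<in> E. x \<in> e} + 1 \<le> 3 * k"
      using exists_low_degree[OF Suc(3-8)] by blast
    define E' where "E' = {e \<in> E. x \<notin> e}"
    have sub: "E' \<subseteq> E" by (auto simp: E'_def)
    have V': "card (V - {x}) = n" "finite (V - {x})" using x Suc(2,6) by auto
    have "V - {x} \<noteq> {}"
    proof
      assume "V - {x} = {}"
      then have "V = {x}" using x by auto
      moreover obtain e where "e \<in> E" using False by blast
      then have "e \<subseteq> V" "card e = 2" using Suc(7) by auto
      ultimately show False using card_mono[of "{x}" e] by auto
    qed
    moreover have "E' \<subseteq> {e. e \<subseteq> V - {x} \<and> card e = 2}" using Suc(7) by (auto simp: E'_def)
    moreover have "no_consec k E'" using no_consec_subset[OF Suc(3) sub] .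
    moreover have "cyc E' xs \<Longrightarrow> length xs + 1 \<le> 3 * k" for xs using Suc(5) cyc_mono[OF _ sub] by blast
    ultimately have IH: "2 * card E' \<le> (3 * k - 1) * (card (V - {x}) - 1)"
      using Suc(1)[of "V - {x}" E'] V' Suc(4) by auto
    have "n \<noteq> 0" using V' \<open>V - {x} \<noteq> {}\<close> by auto
    have "E = E' \<union> {e \<in> E. x \<in> e}" by (auto simp: E'_def)
    then have "card E \<le> card E' + card {e \<in> E. x \<in> e}" by (metis card_Un_le)
    then have "2 * card E \<le> (3 * k - 1) * (n - 1) + (3 * k - 1)"
      using IH[unfolded V'(1)] x(2) by simp
    also have "\<dots> = (3 * k - 1) * n" using \<open>n \<noteq> 0\<close> by (cases n) auto
    finally show ?thesis using Suc(2) by (metis diff_Suc_1)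
  qed auto
qed

section \<open>Bridges\<close>

text \<open>The path \<open>p\<close> is a cycle through \<open>e\<close> with the edge \<open>e\<close> removed.\<close>

definition bridges :: "'a set set \<Rightarrow> 'a set set" where
  "bridges E = {e \<in> E. \<not> (\<exists>p. walk E p \<and> distinct p \<and> 3 \<le> length p \<and> {last p, hd p} = e)}"

definition matching :: "'a set set \<Rightarrow> bool" where
  "matching F \<longleftrightarrow> (\<forall>e\<in>F. \<forall>f\<in>F. e \<inter> f \<noteq> {} \<longrightarrow> e = f)"

definition all_linked :: "'a set set \<Rightarrow> bool" where
  "all_linked E \<longleftrightarrow> (\<forall>xs. cyc E xs \<longrightarrow> triangle_linked E xs)"

lemma matchingD: "matching F \<Longrightarrow> e \<in> F \<Longrightarrow> f \<in> F \<Longrightarrow> e \<inter> f \<noteq> {} \<Longrightarrow> e = f"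
  unfolding matching_def by blast

lemma matching_subset: "matching F \<Longrightarrow> F' \<subseteq> F \<Longrightarrow> matching F'"
  unfolding matching_def by blast

lemma not_bridge: "walk E p \<Longrightarrow> distinct p \<Longrightarrow> 3 \<le> length p \<Longrightarrow> {last p, hd p} \<notin> bridges E"
  unfolding bridges_def by blast

lemma bridges_insert: "bridges (insert e E) \<subseteq> insert e (bridges E)"
  unfolding bridges_def using walk_mono[of E _ "insert e E"] by blast

lemma bridge_walk:
  assumes "{x, y} \<in> bridges E" "walk E p" "distinct p" "hd p = x" "last p = y"
  shows "length p \<le> 2"
proof (rule ccontr)
  assume "\<not> ?thesis"
  then show False using not_bridge[OF assms(2,3)] assms(1) unfolding assms(4,5) by (simp add: insert_commute)
qed

text \<open>If the path meets \<open>y\<close>, each half joins the ends of a bridge and so is that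
  bridge. If it misses \<open>y\<close>, adding \<open>y\<close> at its end gives a second way from
  \<open>x\<close> to \<open>y\<close>, so that \<open>{x, y}\<close> would be no bridge.\<close>

lemma two_bridges_walk:
  assumes b: "{x, y} \<in> bridges E" "{y, z} \<in> bridges E" and ne: "x \<noteq> z"
    and p: "walk E p" "distinct p" "p \<noteq> []" "hd p = x" "last p = z" and y: "y \<noteq> x" "y \<noteq> z"
  shows "p = [x, y, z]"
proof (cases "y \<in> set p")
  case True
  then obtain q r where s: "p = q @ y # r" using split_list by metis
  have "q \<noteq> []" "r \<noteq> []" using s p y by auto
  have "length (q @ [y]) \<le> 2"
    using p s \<open>q \<noteq> []\<close> walk_infix[of E "[]" "q @ [y]" r] by (intro bridge_walk[OF b(1)]) auto
  moreover have "length (y # r) \<le> 2"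
    using p s walk_infix[of E q "y # r" "[]"] by (intro bridge_walk[OF b(2)]) auto
  ultimately show ?thesis using s p \<open>q \<noteq> []\<close> \<open>r \<noteq> []\<close> by (cases q; cases r) auto
next
  case False
  have E: "{y, z} \<in> E" using b by (auto simp: bridges_def)
  obtain p' where p': "p = x # p'" using p by (cases p) auto
  then have "p' \<noteq> []" using p ne by auto
  have "walk E (p @ [y])" using p E by (auto simp: successively_append_iff insert_commute)
  then have "length (p @ [y]) \<le> 2"
    using p False by (intro bridge_walk[OF b(1)]) auto
  then show ?thesis using p' \<open>p' \<noteq> []\<close> by (cases p') auto
qed

section \<open>Linking new cycles to triangles\<close>

lemma triangle_linked_mono: "triangle_linked E xs \<Longrightarrow> E \<subseteq> E' \<Longrightarrow> triangle_linked E' xs"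
  unfolding triangle_linked_def triangle_def using reach_mono by (metis subset_iff)

lemma triangle_linked_set_eq: "triangle_linked E xs \<Longrightarrow> set xs = set ys \<Longrightarrow> triangle_linked E ys"
  unfolding triangle_linked_def by simp

lemma reach_refl: "w \<noteq> x \<Longrightarrow> reach E w x x"
  unfolding reach_def by (intro exI[of _ "[x]"]) auto

text \<open>Deleting one vertex spares \<open>x\<close> or \<open>y\<close>, and each lies on both
  the triangle and the cycle.\<close>

lemma triangle_linked_triangle:
  assumes "triangle E T" "x \<in> T" "y \<in> T" "x \<noteq> y" "x \<in> set xs" "y \<in> set xs"
  shows "triangle_linked E xs"
  unfolding triangle_linked_def using assms reach_refl by metis

text \<open>After deletion of \<open>w\<close>, one of the common vertices \<open>x\<close> and
  \<open>y\<close> survives, and what is left of the cycle \<open>zs\<close> leads from it to where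
  \<open>zs\<close> is joined to the triangle.\<close>

lemma triangle_linked_common_edge:
  assumes "cyc E zs" "triangle_linked E zs" "x \<in> set zs" "y \<in> set zs" "x \<noteq> y" "x \<in> set xs" "y \<in> set xs"
  shows "triangle_linked E xs"
proof -
  obtain T where T: "triangle E T" "\<And>w. \<exists>u\<in>set zs. \<exists>t\<in>T. reach E w u t"
    using assms(2) unfolding triangle_linked_def by blast
  have "\<exists>v\<in>set xs. \<exists>t\<in>T. reach E w v t" for w
  proof -
    obtain u t where u: "u \<in> set zs" "t \<in> T" "reach E w u t" using T(2) by blast
    have "w \<noteq> u" using u(3) unfolding reach_def by (metis hd_in_set)
    obtain v where v: "v \<in> set zs" "v \<in> set xs" "w \<noteq> v" using assms by metis
    have "reach E w v u" using cyc_reach[OF assms(1) v(1) u(1) v(3) \<open>w \<noteq> u\<close>] .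
    then show ?thesis using reach_trans u v(2) by metis
  qed
  then show ?thesis using T(1) unfolding triangle_linked_def by blast
qed

lemma triangleI: "{x, y} \<in> E \<Longrightarrow> {y, z} \<in> E \<Longrightarrow> {x, z} \<in> E \<Longrightarrow> distinct [x, y, z] \<Longrightarrow> triangle E {x, y, z}"
  unfolding triangle_def by (auto simp: insert_commute)

lemma walk_leaves:
  assumes "walk E p" "\<not> walk F p"
  shows "\<exists>x y as bs. p = as @ x # y # bs \<and> {x, y} \<in> E - F"
  using assms
proof (induction p rule: induct_list012)
  case (3 x y r)
  show ?case
  proof (cases "{x, y} \<in> F")
    case True
    then have "\<exists>u v as bs. y # r = as @ u # v # bs \<and> {u, v} \<in> E - F" using 3 by simp
    then show ?thesis by (metis append_Cons)
  next
    case False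
    then show ?thesis using 3(3) by (intro exI[of _ x] exI[of _ y] exI[of _ "[]"] exI[of _ r]) auto
  qed
qed auto

text \<open>A cycle closed by \<open>e\<close> that has an old edge other than a bridge shares this
  edge with an old cycle, which is linked already. There remain the new cycles whose old edges are
  all bridges.\<close>

lemma all_linked_insert:
  assumes "all_linked E"
    and "\<And>ys. walk (bridges E) ys \<Longrightarrow> distinct ys \<Longrightarrow> 3 \<le> length ys \<Longrightarrow> {last ys, hd ys} = e \<Longrightarrow>
      triangle_linked (insert e E) ys"
  shows "all_linked (insert e E)"
  unfolding all_linked_def
proof (intro allI impI)
  fix xs assume c: "cyc (insert e E) xs"
  show "triangle_linked (insert e E) xs"
  proof (cases "cyc E xs")
    case True
    then show ?thesis using assms(1) triangle_linked_mono[of E xs] unfolding all_linked_def by blast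
  next
    case False
    obtain ys where ys: "set ys = set xs" "length ys = length xs" "distinct ys" "walk E ys"
      "{last ys, hd ys} = e" "3 \<le> length ys"
      by (rule cyc_insert[OF c False])
    have "triangle_linked (insert e E) ys"
    proof (cases "walk (bridges E) ys")
      case True
      then show ?thesis using assms(2) ys by blast
    next
      case False
      then obtain x y as bs where xy: "ys = as @ x # y # bs" "{x, y} \<in> E - bridges E"
        using walk_leaves[OF ys(4)] by metis
      then obtain zs where zs: "walk E zs" "distinct zs" "3 \<le> length zs" "{last zs, hd zs} = {x, y}"
        unfolding bridges_def by blast
      then have "cyc E zs" using xy by (auto simp: cyc_def)
      moreover have "zs \<noteq> []" using zs(3) by auto
      then have "{x, y} \<subseteq> set zs" unfolding zs(4)[symmetric] by auto
      ultimately have "triangle_linked E ys"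
        using assms(1) xy ys(3) by (intro triangle_linked_common_edge[of E zs x y ys]) (auto simp: all_linked_def)
      then show ?thesis by (rule triangle_linked_mono) auto
    qed
    then show ?thesis using ys(1) by (rule triangle_linked_set_eq)
  qed
qed

lemma triangle_linked_insert_3:
  assumes "walk E ys" "distinct ys" "length ys = 3" "{last ys, hd ys} = e"
  shows "triangle_linked (insert e E) ys"
proof -
  obtain x y z where ys: "ys = [x, y, z]" using assms(3) by (auto simp: length_Suc_conv eval_nat_numeral)
  have "triangle (insert e E) {x, y, z}" using assms ys by (intro triangleI) (auto simp: insert_commute)
  then show ?thesis using assms(2) ys by (intro triangle_linked_triangle[of _ _ x y]) auto
qed

text \<open>Of two successive bridges on a path, one must be \<open>b\<close>. A path of four
  bridges contains two such pairs without a common edge, so \<open>e\<close> closes a path of at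
  most three bridges: it makes a triangle, which is linked to itself, or a square.\<close>

lemma all_linked_or_square:
  assumes "all_linked E" "matching (bridges E - {b})"
  shows "all_linked (insert e E) \<or> (\<exists>x y z w. distinct [x, y, z, w] \<and> {x, y} \<in> bridges E \<and>
     {y, z} \<in> bridges E \<and> {z, w} \<in> bridges E \<and> e = {w, x})"
proof (rule disjCI)
  assume no: "\<not> (\<exists>x y z w. distinct [x, y, z, w] \<and> {x, y} \<in> bridges E \<and>
     {y, z} \<in> bridges E \<and> {z, w} \<in> bridges E \<and> e = {w, x})"
  show "all_linked (insert e E)"
  proof (rule all_linked_insert[OF assms(1)])
    fix ys assume ys: "walk (bridges E) ys" "distinct ys" "3 \<le> length ys" "{last ys, hd ys} = e"
    have b: "b = {x, y} \<or> b = {y, z}" if "{x, y} \<in> bridges E" "{y, z} \<in> bridges E" "x \<noteq> z" for x y z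
    proof (rule ccontr)
      assume "\<not> ?thesis"
      then have "{x, y} \<noteq> b" "{y, z} \<noteq> b" by metis+
      then have "{x, y} = {y, z}"
        using that by (intro matchingD[OF assms(2)] DiffI) simp_all
      then show False using that(3) by (auto simp: doubleton_eq_iff)
    qed
    obtain x y z r where r: "ys = x # y # z # r" using ys(3) by (auto simp: numeral_3_eq_3 Suc_le_length_iff)
    show "triangle_linked (insert e E) ys"
    proof (cases r)
      case Nil
      then show ?thesis using ys r walk_mono[OF ys(1), of E]
        by (intro triangle_linked_insert_3) (auto simp: bridges_def)
    next
      case (Cons w s)
      show ?thesis
      proof (cases s)
        case Nil
        then have "distinct [x, y, z, w]" "{x, y} \<in> bridges E" "{y, z} \<in> bridges E"
          "{z, w} \<in> bridges E" "e = {w, x}"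
          using ys unfolding r Cons by simp_all
        then show ?thesis using no by blast
      next
        case (Cons v t)
        have *: "walk (bridges E) (x # y # z # w # v # t)" "distinct (x # y # z # w # v # t)"
          using ys(1,2) unfolding r \<open>r = w # s\<close> Cons by simp_all
        have "b = {x, y} \<or> b = {y, z}" by (rule b) (use * in simp_all)
        moreover have "b = {z, w} \<or> b = {w, v}" by (rule b) (use * in simp_all)
        ultimately show ?thesis using *(2) by (auto simp: doubleton_eq_iff)
      qed
    qed
  qed
qed

text \<open>A matching contains no path of two edges, so \<open>e\<close> has no path of bridges to
  close.\<close>

lemma all_linked_insert_matching:
  assumes "all_linked E" "matching (bridges E)"
  shows "all_linked (insert e E)"
proof (rule all_linked_insert[OF assms(1)])
  fix ys assume ys: "walk (bridges E) ys" "distinct ys" "3 \<le> length ys"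
  then obtain x y z r where r: "ys = x # y # z # r" by (auto simp: numeral_3_eq_3 Suc_le_length_iff)
  then have "{x, y} = {y, z}" using ys by (intro matchingD[OF assms(2)]) simp_all
  then show "triangle_linked (insert e E) ys" using ys r by (auto simp: doubleton_eq_iff)
qed

text \<open>The path through \<open>y\<close> is the only one from \<open>x\<close> to
  \<open>z\<close>, so the only cycle that the chord makes is a triangle, whose edges are not
  bridges.\<close>

lemma close_two_bridges:
  assumes ag: "all_linked E" and b: "{x, y} \<in> bridges E" "{y, z} \<in> bridges E" and d: "distinct [x, y, z]"
  defines "E' \<equiv> insert {x, z} E"
  shows "{x, z} \<notin> E" and "all_linked E'" and "bridges E' \<subseteq> bridges E - {{x, y}, {y, z}}"
    and "cyc E' xs \<Longrightarrow> cyc E xs \<or> length xs = 3"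
proof -
  have E: "{x, y} \<in> E" "{y, z} \<in> E" using b by (auto simp: bridges_def)
  show "{x, z} \<notin> E" using two_bridges_walk[OF b, of "[x, z]"] d by auto
  have new: "length ys = 3" if ys: "walk E ys" "distinct ys" "3 \<le> length ys" "{last ys, hd ys} = {x, z}" for ys
  proof -
    have ne: "ys \<noteq> []" using ys by auto
    consider "hd ys = x" "last ys = z" | "hd (rev ys) = x" "last (rev ys) = z"
      using ys(4) ne by (auto simp: doubleton_eq_iff hd_rev last_rev)
    then show ?thesis
    proof cases
      case 1
      then have "ys = [x, y, z]" using d by (intro two_bridges_walk[OF b _ ys(1,2) ne]) auto
      then show ?thesis by simp
    next
      case 2
      then have "rev ys = [x, y, z]" using ys ne d walk_rev[of E ys] by (intro two_bridges_walk[OF b]) auto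
      then show ?thesis by (metis length_rev length_Cons list.size(3) numeral_3_eq_3)
    qed
  qed
  show "all_linked E'" unfolding E'_def
  proof (rule all_linked_insert[OF ag])
    fix ys assume ys: "walk (bridges E) ys" "distinct ys" "3 \<le> length ys" "{last ys, hd ys} = {x, z}"
    have "walk E ys" using ys(1) by (rule walk_mono) (auto simp: bridges_def)
    then show "triangle_linked (insert {x, z} E) ys" using triangle_linked_insert_3 new ys by metis
  qed
  show "cyc E xs \<or> length xs = 3" if "cyc E' xs"
    using that cyc_insert[of "{x, z}" E xs] new unfolding E'_def by metis
  have "{x, z} \<notin> bridges E'" "{x, y} \<notin> bridges E'" "{y, z} \<notin> bridges E'"
    using not_bridge[of E' "[x, y, z]"] not_bridge[of E' "[x, z, y]"] not_bridge[of E' "[y, x, z]"] E d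
    by (auto simp: E'_def insert_commute)
  then show "bridges E' \<subseteq> bridges E - {{x, y}, {y, z}}"
    using bridges_insert[of "{x, z}" E] unfolding E'_def by auto
qed

text \<open>\<open>E1\<close> is the position after Max has closed a square over three bridges. The
  only paths in it from \<open>x\<close> to \<open>z\<close> go round the square, so the diagonal
  creates only triangles. A cycle through \<open>{w, x}\<close> or through the diagonal shares two
  vertices with one of these.\<close>

lemma chord_of_square:
  assumes ag: "all_linked E" and b: "{x, y} \<in> bridges E" "{y, z} \<in> bridges E" "{z, w} \<in> bridges E"
    and d: "distinct [x, y, z, w]"
  defines "E1 \<equiv> insert {w, x} E"
  defines "E2 \<equiv> insert {x, z} E1"
  shows "{x, z} \<notin> E1" and "all_linked E2" and "bridges E2 \<subseteq> bridges E"
    and "cyc E2 xs \<Longrightarrow> cyc E1 xs \<or> length xs = 3"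
proof -
  have E: "{x, y} \<in> E" "{y, z} \<in> E" "{z, w} \<in> E" using b by (auto simp: bridges_def)
  show "{x, z} \<notin> E1"
    using two_bridges_walk[OF b(1,2), of "[x, z]"] d by (auto simp: E1_def doubleton_eq_iff)
  have T: "triangle E2 {x, y, z}" "triangle E2 {x, z, w}"
    using E d by (auto intro!: triangleI simp: E1_def E2_def insert_commute)
  have new: "length ys = 3" if ys: "walk E1 ys" "distinct ys" "3 \<le> length ys" "hd ys = x" "last ys = z" for ys
  proof (cases "walk E ys")
    case True
    have "ys \<noteq> []" using ys by auto
    then have "ys = [x, y, z]" using True ys d by (intro two_bridges_walk[OF b(1,2)]) auto
    then show ?thesis by simp
  next
    case False
    then have "\<not> walk (E1 - {{w, x}}) ys" using walk_mono[of "E1 - {{w, x}}" ys E] by (auto simp: E1_def)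
    then obtain as u v bs where s: "ys = as @ u # v # bs" "{w, x} = {u, v}" "walk (E1 - {{w, x}}) (v # bs)"
      using walk_split_edge[OF ys(1,2)] by blast
    \<comment> \<open>A path from \<open>x\<close> that uses the new edge \<open>{w, x}\<close>
      starts with it; the rest joins \<open>w\<close> to \<open>z\<close>, the ends of a
      bridge.\<close>
    have as: "as = []" "u = x" "v = w"
      using ys(2,4) s(1,2) d by (cases as; auto simp: doubleton_eq_iff)+
    have "walk E (w # bs)" using s(3) as walk_mono[of "E1 - {{w, x}}" _ E] by (auto simp: E1_def)
    then have "length (w # bs) \<le> 2"
      using ys s(1) as b(3) by (intro bridge_walk[of w z E]) (auto simp: insert_commute)
    then show ?thesis using ys(3) s(1) as by simp
  qed
  show "cyc E1 xs \<or> length xs = 3" if c: "cyc E2 xs"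
  proof (rule disjCI)
    assume no: "length xs \<noteq> 3"
    show "cyc E1 xs"
    proof (rule ccontr)
      assume "\<not> cyc E1 xs"
      then obtain ys where ys: "length ys = length xs" "distinct ys" "walk E1 ys"
          "{last ys, hd ys} = {x, z}" "3 \<le> length ys"
        using cyc_insert[of "{x, z}" E1 xs] c unfolding E2_def by metis
      have "ys \<noteq> []" using ys(5) by auto
      then consider "hd ys = x" "last ys = z" | "hd (rev ys) = x" "last (rev ys) = z"
        using ys(4) by (auto simp: doubleton_eq_iff hd_rev last_rev)
      then show False using new[of ys] new[of "rev ys"] ys no walk_rev[of E1 ys] by cases auto
    qed
  qed
  show "all_linked E2" unfolding all_linked_def
  proof (intro allI impI)
    fix xs assume c: "cyc E2 xs"
    consider "cyc E xs" | "cyc E1 xs" "\<not> cyc E xs" | "\<not> cyc E1 xs" by blast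
    then show "triangle_linked E2 xs"
    proof cases
      case 1
      then show ?thesis using ag triangle_linked_mono[of E xs E2] by (auto simp: all_linked_def E1_def E2_def)
    next
      case 2
      obtain ys where ys: "set ys = set xs" "{last ys, hd ys} = {w, x}" "3 \<le> length ys"
        by (rule cyc_insert[OF 2[unfolded E1_def]])
      have "ys \<noteq> []" using ys(3) by auto
      then have "{w, x} \<subseteq> set xs" unfolding ys(1,2)[symmetric] by auto
      then show ?thesis using d by (intro triangle_linked_triangle[OF T(2), of x w]) auto
    next
      case 3
      obtain ys where ys: "set ys = set xs" "{last ys, hd ys} = {x, z}" "3 \<le> length ys"
        by (rule cyc_insert[OF c[unfolded E2_def] 3])
      have "ys \<noteq> []" using ys(3) by auto
      then have "{x, z} \<subseteq> set xs" unfolding ys(1,2)[symmetric] by auto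
      then show ?thesis using d by (intro triangle_linked_triangle[OF T(1), of x z]) auto
    qed
  qed
  have "{x, z} \<notin> bridges E2" "{w, x} \<notin> bridges E2"
    using not_bridge[of E2 "[x, y, z]"] not_bridge[of E2 "[x, z, w]"] E d
    by (auto simp: E1_def E2_def insert_commute)
  then show "bridges E2 \<subseteq> bridges E"
    using bridges_insert[of "{x, z}" E1] bridges_insert[of "{w, x}" E] unfolding E1_def E2_def by auto
qed

section \<open>The game\<close>

definition avoids :: "nat set \<Rightarrow> 'a set set \<Rightarrow> bool" where
  "avoids L E \<longleftrightarrow> (\<forall>xs. cyc E xs \<longrightarrow> length xs \<notin> L)"

lemma no_consec_avoids:
  assumes "avoids L E" "\<forall>l\<ge>k. l \<in> L \<or> l + 1 \<in> L"
  shows "no_consec k E"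
  using assms unfolding avoids_def no_consec_def by (metis Suc_eq_plus1)

text \<open>To hold whenever Max is to move. The edge \<open>b\<close> is arbitrary, so bridges that
  form a matching without exception are included.\<close>

definition mini_inv :: "nat set \<Rightarrow> 'a set set \<Rightarrow> bool" where
  "mini_inv L E \<longleftrightarrow> avoids L E \<and> all_linked E \<and> (\<exists>b. matching (bridges E - {b}))"

lemma not_matching_bridges:
  assumes "\<not> matching (bridges E)" "\<And>e. e \<in> E \<Longrightarrow> card e = 2"
  obtains x y z where "{x, y} \<in> bridges E" "{y, z} \<in> bridges E" "distinct [x, y, z]"
proof -
  obtain e f y where ef: "e \<in> bridges E" "f \<in> bridges E" "e \<noteq> f" "y \<in> e" "y \<in> f"
    using assms(1) unfolding matching_def by blast
  have "card e = 2" "card f = 2" using ef assms(2) by (auto simp: bridges_def)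
  then obtain x z where "e = {x, y}" "f = {y, z}" "x \<noteq> y" "y \<noteq> z"
    using ef(4,5) unfolding card_2_iff by (metis doubleton_eq_iff insertE singletonD)
  then show ?thesis using that ef by auto
qed

text \<open>The exceptional edge is \<open>f\<close> itself, the only possible new bridge.\<close>

lemma mini_inv_any_move:
  assumes "all_linked E" "matching (bridges E)" "avoids L (insert f E)"
  shows "mini_inv L (insert f E)"
proof -
  have "bridges (insert f E) - {f} \<subseteq> bridges E" using bridges_insert by blast
  then show ?thesis using assms all_linked_insert_matching matching_subset unfolding mini_inv_def by blast
qed

text \<open>The reply creates no new cycles but triangles, and \<open>3 \<notin> L\<close> allows
  these. Taking \<open>x\<close> and \<open>z\<close> from the edges present keeps the chord inside
  the vertex set of the game.\<close>

lemma mini_chord_move: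
  assumes inv: "mini_inv L E" and av: "avoids L (insert e E)" and L3: "3 \<notin> L"
    and card2: "\<And>f. f \<in> insert e E \<Longrightarrow> card f = 2"
    and bad: "\<not> all_linked (insert e E) \<or> \<not> matching (bridges (insert e E))"
  shows "\<exists>x\<in>\<Union>(insert e E). \<exists>z\<in>\<Union>(insert e E). x \<noteq> z \<and> {x, z} \<notin> insert e E \<and>
    mini_inv L (insert {x, z} (insert e E))"
proof -
  obtain b where b: "all_linked E" "matching (bridges E - {b})" using inv unfolding mini_inv_def by blast
  show ?thesis
  proof (cases "all_linked (insert e E)")
    case False
    then obtain x y z w where sq: "distinct [x, y, z, w]" "{x, y} \<in> bridges E" "{y, z} \<in> bridges E"
        "{z, w} \<in> bridges E" "e = {w, x}"
      using all_linked_or_square[OF b, of e] by metis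
    note ch = chord_of_square[OF b(1) sq(2-4,1), folded sq(5)]
    have "avoids L (insert {x, z} (insert e E))"
      using ch(4) av L3 unfolding avoids_def by metis
    moreover have "matching (bridges (insert {x, z} (insert e E)) - {b})"
      by (rule matching_subset[OF b(2)]) (rule Diff_mono[OF ch(3) order.refl])
    moreover have "{x, y} \<in> E" "{y, z} \<in> E" using sq by (auto simp: bridges_def)
    then have "x \<in> \<Union>(insert e E)" "z \<in> \<Union>(insert e E)" by auto
    moreover have "x \<noteq> z" using sq(1) by auto
    ultimately show ?thesis using ch(1,2) unfolding mini_inv_def
      by (intro bexI[of _ x] bexI[of _ z] conjI exI[of _ b])
  next
    case True
    then have "\<not> matching (bridges (insert e E))" using bad by simp
    then obtain x y z where t: "{x, y} \<in> bridges (insert e E)" "{y, z} \<in> bridges (insert e E)" "distinct [x, y, z]"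
      by (rule not_matching_bridges[OF _ card2])
    note ch = close_two_bridges[OF True t]
    have "avoids L (insert {x, z} (insert e E))"
      using ch(4) av L3 unfolding avoids_def by metis
    moreover obtain c where "matching (bridges (insert {x, z} (insert e E)) - {c})"
    proof -
      have m: "matching (bridges (insert e E) - {b, e})"
        by (rule matching_subset[OF b(2)]) (use bridges_insert[of e E] in blast)
      \<comment> \<open>Apart from \<open>b\<close> and Max's edge \<open>e\<close> the bridges form
        a matching, so two bridges that meet include \<open>b\<close> or \<open>e\<close>. The chord
        makes that edge lie on a cycle, and \<open>c\<close> is the other of the two.\<close>
      have "{x, y} \<in> {b, e} \<or> {y, z} \<in> {b, e}"
      proof (rule ccontr)
        assume "\<not> ?thesis"
        then have "{x, y} \<in> bridges (insert e E) - {b, e}" "{y, z} \<in> bridges (insert e E) - {b, e}"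
          using t(1,2) by simp_all
        then have "{x, y} = {y, z}" by (rule matchingD[OF m]) simp
        then show False using t(3) by (auto simp: doubleton_eq_iff)
      qed
      then have "{b, e} \<subseteq> {b, {x, y}, {y, z}} \<or> {b, e} \<subseteq> {e, {x, y}, {y, z}}" by (elim disjE insertE) simp_all
      then obtain c where c: "{b, e} \<subseteq> {c, {x, y}, {y, z}}" by (elim disjE)
      have "N - {c} \<subseteq> M - {b, e}" if "N \<subseteq> M - {g, h}" "{b, e} \<subseteq> {c, g, h}" for N M and g h :: "'a set"
        using that by blast
      from this[OF ch(3) c]
      have "matching (bridges (insert {x, z} (insert e E)) - {c})" by (rule matching_subset[OF m])
      then show ?thesis by (rule that)
    qed
    moreover have "{x, y} \<in> insert e E" "{y, z} \<in> insert e E" using t(1,2) unfolding bridges_def by simp_all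
    then have "x \<in> \<Union>(insert e E)" "z \<in> \<Union>(insert e E)" by (meson UnionI insertI1 insertI2)+
    moreover have "x \<noteq> z" using t(3) by auto
    ultimately show ?thesis using ch(1,2) unfolding mini_inv_def
      by (intro bexI[of _ x] bexI[of _ z] conjI exI[of _ c])
  qed
qed

section \<open>Forbidden subgraphs as cycle lengths, and strategies\<close>

lemma has_cycle_iff:
  assumes E: "E \<subseteq> all_pairs n" and l: "3 \<le> l"
  shows "has_subgraph_iso ({..<n}, E) (cycle_graph l) \<longleftrightarrow> (\<exists>xs. cyc E xs \<and> length xs = l)"
proof
  assume "has_subgraph_iso ({..<n}, E) (cycle_graph l)"
  then obtain f where f: "inj_on f {..<l}" and im: "(`) f ` {{i, Suc i mod l} | i. i < l} \<subseteq> E"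
    unfolding has_subgraph_iso_def cycle_graph_def by auto
  have e: "f ` {i, Suc i mod l} \<in> E" if "i < l" for i using im that by blast
  have "walk E (map f [0..<l])"
    unfolding successively_conv_nth
  proof (intro allI impI)
    fix i assume "Suc i < length (map f [0..<l])"
    then show "{map f [0..<l] ! i, map f [0..<l] ! Suc i} \<in> E" using e[of i] by simp
  qed
  moreover have "distinct (map f [0..<l])" using f by (simp add: distinct_map atLeast0LessThan)
  \<comment> \<open>At index \<open>l - 1\<close> the successor wraps round to
    \<open>0\<close>.\<close>
  moreover have "{last (map f [0..<l]), hd (map f [0..<l])} \<in> E"
    using e[of "l - 1"] l by (simp add: last_map hd_map)
  ultimately show "\<exists>xs. cyc E xs \<and> length xs = l"
    using l by (intro exI[of _ "map f [0..<l]"]) (simp add: cyc_def)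
next
  assume "\<exists>xs. cyc E xs \<and> length xs = l"
  then obtain xs where xs: "cyc E xs" "length xs = l" by blast
  have e: "{xs ! i, xs ! (Suc i mod l)} \<in> E" if "i < l" for i
  proof (cases "Suc i < l")
    case True
    then show ?thesis using xs by (simp add: cyc_def successively_conv_nth)
  next
    case False
    then have "Suc i = l" using that by simp
    moreover have "xs \<noteq> []" using xs l by auto
    ultimately show ?thesis using xs by (auto simp: cyc_def last_conv_nth hd_conv_nth)
  qed
  have "inj_on ((!) xs) {..<l}" using xs by (auto simp: cyc_def inj_on_def nth_eq_iff_index_eq)
  \<comment> \<open>Every vertex of the cycle lies on an edge of \<open>E\<close>.\<close>
  moreover have "(!) xs ` {..<l} \<subseteq> {..<n}" using e E by (fastforce simp: all_pairs_def)
  ultimately show "has_subgraph_iso ({..<n}, E) (cycle_graph l)"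
    unfolding has_subgraph_iso_def cycle_graph_def using e by (intro exI[of _ "(!) xs"]) auto
qed

text \<open>Both sides concern lengths at least 3, where \<open>cycle_graph\<close> is a genuine
  cycle: \<open>\<C>\<close> has only such members, and \<open>cyc\<close> demands such a
  length.\<close>

lemma family_free_cycles:
  assumes "\<C> \<subseteq> {cycle_graph l | l. l \<ge> 3}" "E \<subseteq> all_pairs n"
  shows "family_free \<C> ({..<n}, E) \<longleftrightarrow> avoids {l. cycle_graph l \<in> \<C>} E"
proof
  assume f: "family_free \<C> ({..<n}, E)"
  show "avoids {l. cycle_graph l \<in> \<C>} E"
    using f has_cycle_iff[OF assms(2)] unfolding avoids_def family_free_def cyc_def by blast
next
  assume a: "avoids {l. cycle_graph l \<in> \<C>} E"
  show "family_free \<C> ({..<n}, E)"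
    unfolding family_free_def
  proof
    fix H assume H: "H \<in> \<C>"
    then obtain l where "H = cycle_graph l" "3 \<le> l" using assms(1) by blast
    then show "\<not> has_subgraph_iso ({..<n}, E) H"
      using has_cycle_iff[OF assms(2)] a H unfolding avoids_def by blast
  qed
qed

text \<open>A strategy for Mini, given by an invariant \<open>P\<close> of the positions with Max to
  move. The game may be over before Max's move or after it, hence the two places where
  \<open>B\<close> must bound the edges.\<close>

lemma game_value_le:
  assumes "P E"
    and step: "\<And>E e. P E \<Longrightarrow> e \<in> legal_moves n F E \<Longrightarrow>
       if legal_moves n F (insert e E) = {} then card (insert e E) \<le> B
       else \<exists>f\<in>legal_moves n F (insert e E). P (insert f (insert e E))"
    and stop: "\<And>E. P E \<Longrightarrow> legal_moves n F E = {} \<Longrightarrow> card E \<le> B"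
  shows "game_value n F True E \<le> B"
  using assms(1)
proof (induction "card (all_pairs n - E)" arbitrary: E rule: less_induct)
  case less
  have fin: "finite (legal_moves n F E)" for E by (auto simp: legal_moves_def finite_all_pairs)
  show ?case
  proof (cases "legal_moves n F E = {}")
    case True
    then show ?thesis using stop[OF less(2)] by (subst game_value.simps) simp
  next
    case False
    have "game_value n F False (insert e E) \<le> B" if e: "e \<in> legal_moves n F E" for e
    proof (cases "legal_moves n F (insert e E) = {}")
      case True
      then show ?thesis using step[OF less(2) e] by (subst game_value.simps) simp
    next
      case False
      then obtain f where f: "f \<in> legal_moves n F (insert e E)" "P (insert f (insert e E))"
        using step[OF less(2) e] by auto
      have "all_pairs n - insert f (insert e E) \<subset> all_pairs n - E"
        using e by (auto simp: legal_moves_def)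
      then have "card (all_pairs n - insert f (insert e E)) < card (all_pairs n - E)"
        by (intro psubset_card_mono) (auto simp: finite_all_pairs)
      then have "game_value n F True (insert f (insert e E)) \<le> B" using less(1) f(2) by blast
      then have "Min ((\<lambda>f. game_value n F True (insert f (insert e E))) ` legal_moves n F (insert e E)) \<le> B"
        using fin f(1) by (intro order.trans[OF Min_le]) auto
      then show ?thesis using False by (subst game_value.simps) simp
    qed
    then show ?thesis using False fin by (subst game_value.simps) auto
  qed
qed

theorem theorem1p3:
  fixes \<C> :: "nat graph set" and k n :: nat
  assumes "\<C> \<subseteq> {cycle_graph l | l. l \<ge> 3}"
    and "cycle_graph 3 \<notin> \<C>"
    and "k \<ge> 3"
    and "\<forall>l\<ge>k. cycle_graph l \<in> \<C> \<or> cycle_graph (l + 1) \<in> \<C>"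
    and "n \<ge> 1"
  shows "real (sat_g n \<C>) \<le> 1 / 2 * (3 * real k - 1) * (real n - 1)"
proof -
  define L where "L = {l. cycle_graph l \<in> \<C>}"
  \<comment> \<open>The value of the game is an integer, so the bound may be rounded down.\<close>
  define B where "B = (3 * k - 1) * (n - 1) div 2"
  have L: "3 \<notin> L" "\<forall>l\<ge>k. l \<in> L \<or> l + 1 \<in> L" using assms(2,4) by (auto simp: L_def)
  have legal: "e \<in> legal_moves n \<C> E \<longleftrightarrow> e \<in> all_pairs n \<and> e \<notin> E \<and> avoids L (insert e E)"
    if "E \<subseteq> all_pairs n" for e E
    using that family_free_cycles[OF assms(1), of "insert e E" n] by (auto simp: legal_moves_def L_def)
  have bound: "card E \<le> B" if E: "E \<subseteq> all_pairs n" "avoids L E" "all_linked E" for E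
  proof -
    have k: "no_consec k E" using no_consec_avoids E(2) L(2) .
    have fin: "finite E" using E(1) finite_all_pairs finite_subset by blast
    have long: "length xs + 1 \<le> 3 * k" if "cyc E xs" for xs
      using triangle_linked_length[OF fin k assms(3) that] E(3) that unfolding all_linked_def by fastforce
    have ne: "{..<n} \<noteq> {}" using assms(5) by (simp add: lessThan_empty_iff)
    have "2 * card E \<le> (3 * k - 1) * (card {..<n} - 1)"
      by (rule no_consec_card_edges[OF k assms(3) long]) (use E(1) ne in \<open>auto simp: all_pairs_def\<close>)
    then show ?thesis by (simp add: B_def)
  qed
  have "game_value n \<C> True {} \<le> B"
  proof (rule game_value_le[where P = "\<lambda>E. E \<subseteq> all_pairs n \<and> mini_inv L E"])
    show "{} \<subseteq> all_pairs n \<and> mini_inv L ({} :: nat set set)"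
      by (auto simp: mini_inv_def avoids_def all_linked_def cyc_def bridges_def matching_def)
    show "card E \<le> B" if "E \<subseteq> all_pairs n \<and> mini_inv L E" for E
      using bound that unfolding mini_inv_def by blast
    fix E e assume P: "E \<subseteq> all_pairs n \<and> mini_inv L E" and e: "e \<in> legal_moves n \<C> E"
    let ?E = "insert e E"
    have E: "?E \<subseteq> all_pairs n" and av: "avoids L ?E" using P e legal by auto
    have card2: "card f = 2" if "f \<in> ?E" for f using E that by (auto simp: all_pairs_def)
    have chord: "\<exists>f\<in>legal_moves n \<C> ?E. mini_inv L (insert f ?E)"
      if bad: "\<not> all_linked ?E \<or> \<not> matching (bridges ?E)"
    proof -
      obtain x z where xz: "x \<in> \<Union>?E" "z \<in> \<Union>?E" "x \<noteq> z" "{x, z} \<notin> ?E" "mini_inv L (insert {x, z} ?E)"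
        using mini_chord_move[OF _ av L(1) card2 bad] P by blast
      then have "{x, z} \<in> all_pairs n" using E by (auto simp: all_pairs_def)
      then have "{x, z} \<in> legal_moves n \<C> ?E" using legal[OF E] xz(4,5) by (auto simp: mini_inv_def)
      then show ?thesis using xz(5) by blast
    qed
    show "if legal_moves n \<C> ?E = {} then card ?E \<le> B
       else \<exists>f\<in>legal_moves n \<C> ?E. insert f ?E \<subseteq> all_pairs n \<and> mini_inv L (insert f ?E)"
    proof (cases "legal_moves n \<C> ?E = {}")
      case True
      \<comment> \<open>If the game is over after Max's move, the position still satisfies
        \<open>all_linked\<close>, for otherwise the chord would be a legal move.\<close>
      then show ?thesis using chord bound[OF E av] by auto
    next
      case False
      then obtain g where g: "g \<in> legal_moves n \<C> ?E" by blast
      have "\<exists>f\<in>legal_moves n \<C> ?E. mini_inv L (insert f ?E)"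
      \<comment> \<open>If Max's move leaves both conditions intact, any legal \<open>g\<close> will
        do.\<close>
      proof (cases "all_linked ?E \<and> matching (bridges ?E)")
        case True
        then show ?thesis using mini_inv_any_move g legal[OF E] by blast
      qed (use chord in blast)
      then show ?thesis using False E legal[OF E] by auto
    qed
  qed
  then have "2 * sat_g n \<C> \<le> (3 * k - 1) * (n - 1)" unfolding sat_g_def B_def by linarith
  then have "real (2 * sat_g n \<C>) \<le> real ((3 * k - 1) * (n - 1))" by (simp only: of_nat_le_iff)
  then show ?thesis using assms(3,5) by (simp add: of_nat_diff)
qed

end
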